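(* Let $T$ be a finite tree that is an SR-graph and let $e\in E(T)$. Then $e$ is a bondage edge of $T$ if and only if one of the ends of $e$ is a leaf and the other is a strong support vertex.
   Context: $\gamma(G)$ denotes the domination number of a finite simple graph $G$. For an edge $e=uv$ of $G$, $G-e$ is the graph obtained by deleting $e$, and $G_e$ is the graph obtained by subdividing $e$: delete $e$, add a new vertex $w$ and the edges $uw$ and $wv$. A finite connected simple graph $G$ of order at least two is an SR-graph (sub-removable graph) if $\gamma(G-e)=\gamma(G_e)$ for every edge $e$ of $G$. An edge $e$ of $G$ is a bondage edge if $\gamma(G-e)>\gamma(G)$. A leaf is a vertex of degree $1$. A strong support vertex is a vertex adjacent to at least two leaves. *)

theory Defs
  imports "Graph_Theory.Digraph_Component"
begin

text \<open>
  Finite simple graphs are \<^locale>\<open>pair_graph\<close>s: finite, loop-free, symmetric digraphs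
  without parallel arcs. An undirected edge \<open>uv\<close> is the pair of arcs \<open>(u, v)\<close>, \<open>(v, u)\<close> and is
  referred to by either arc; the operations below treat both orientations alike.
\<close>

text \<open>
  The library's \<^const>\<open>forest\<close> and \<^const>\<open>tree\<close> count \<open>u, v, u\<close> as a cycle, so no symmetric
  digraph with an arc satisfies them. Undirected cycles are the directed ones of length
  at least 3.
\<close>

definition undirected_tree :: "'a pair_pre_digraph \<Rightarrow> bool" where
  "undirected_tree G \<longleftrightarrow>
     pair_graph G \<and> connected (with_proj G) \<and>
     \<not> (\<exists>p. pre_digraph.cycle (with_proj G) p \<and> length p \<ge> 3)"

definition dominating_set :: "'a pair_pre_digraph \<Rightarrow> 'a set \<Rightarrow> bool" where
  "dominating_set G D \<longleftrightarrow>
     D \<subseteq> pverts G \<and> (\<forall>v \<in> pverts G - D. \<exists>u \<in> D. (u, v) \<in> parcs G)"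

definition domination_number :: "'a pair_pre_digraph \<Rightarrow> nat" where
  "domination_number G = Min (card ` {D. dominating_set G D})"

definition delete_edge :: "'a pair_pre_digraph \<Rightarrow> 'a \<times> 'a \<Rightarrow> 'a pair_pre_digraph" where
  "delete_edge G e = G\<lparr>parcs := parcs G - {(fst e, snd e), (snd e, fst e)}\<rparr>"

text \<open>
  Embedding the vertices into the option type leaves \<^const>\<open>None\<close> available as the new vertex,
  so a fresh vertex exists even when the graph exhausts its vertex type.
\<close>

definition subdivide_edge :: "'a pair_pre_digraph \<Rightarrow> 'a \<times> 'a \<Rightarrow> 'a option pair_pre_digraph" where
  "subdivide_edge G e =
     subdivide \<lparr>pverts = Some ` pverts G, parcs = map_prod Some Some ` parcs G\<rparr>
       (map_prod Some Some e) None"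

definition sr_graph :: "'a pair_pre_digraph \<Rightarrow> bool" where
  "sr_graph G \<longleftrightarrow>
     pair_graph G \<and> connected (with_proj G) \<and> card (pverts G) \<ge> 2 \<and>
     (\<forall>e \<in> parcs G. domination_number (delete_edge G e) = domination_number (subdivide_edge G e))"

definition bondage_edge :: "'a pair_pre_digraph \<Rightarrow> 'a \<times> 'a \<Rightarrow> bool" where
  "bondage_edge G e \<longleftrightarrow>
     e \<in> parcs G \<and> domination_number (delete_edge G e) > domination_number G"

text \<open>By symmetry of the arc relation, the out-degree is the degree of the undirected graph.\<close>

definition leaf :: "'a pair_pre_digraph \<Rightarrow> 'a \<Rightarrow> bool" where
  "leaf G v \<longleftrightarrow> v \<in> pverts G \<and> out_degree (with_proj G) v = 1"

definition strong_support_vertex :: "'a pair_pre_digraph \<Rightarrow> 'a \<Rightarrow> bool" where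
  "strong_support_vertex G v \<longleftrightarrow>
     v \<in> pverts G \<and> card {w. leaf G w \<and> (v, w) \<in> parcs G} \<ge> 2"

lemma delete_edge_swap: "delete_edge G (v, u) = delete_edge G (u, v)"
  by (simp add: delete_edge_def insert_commute)

lemma subdivide_edge_swap: "subdivide_edge G (v, u) = subdivide_edge G (u, v)"
  by (simp add: subdivide_edge_def subdivide.simps insert_commute)

lemma pair_graph_delete_edge:
  assumes "pair_graph G"
  shows "pair_graph (delete_edge G e)"
proof -
  interpret pair_graph G by fact
  show ?thesis
    by unfold_locales
      (auto simp: delete_edge_def symmetric_def pair_finite_verts pair_finite_arcs
        intro!: symI intro: arcs_symmetric dest: no_loops' in_arcsD1 in_arcsD2)
qed

lemma pair_graph_subdivide_edge:
  assumes "pair_graph G" "e \<in> parcs G"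
  shows "pair_graph (subdivide_edge G e)"
proof -
  interpret pair_graph G by fact
  let ?H = "\<lparr>pverts = Some ` pverts G, parcs = map_prod Some Some ` parcs G\<rparr>"
  have "pair_graph ?H"
    by unfold_locales
      (auto simp: symmetric_def pair_finite_verts pair_finite_arcs
        intro!: symI intro: arcs_symmetric dest: no_loops' in_arcsD1 in_arcsD2)
  then show ?thesis
    unfolding subdivide_edge_def using assms(2)
    by (intro pair_graph.pair_graph_subdivide) auto
qed

end

theory Submission
  imports Defs
begin

text \<open>
  If \<open>uv\<close> is a bondage edge, every minimum dominating set contains exactly one of \<open>u\<close>, \<open>v\<close>, and this
  one is the only dominator of the other. In an SR-tree it is moreover always the same end, say \<open>v\<close>:
  cutting the tree at \<open>uv\<close> and exchanging the parts of two minimum dominating sets containing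
  different ends would give a dominating set of size \<open>\<gamma>(T)\<close> in the subdivision. Then \<open>u\<close> is a leaf:
  if \<open>c\<close> were another neighbour of \<open>u\<close>, then \<open>uc\<close> is not a bondage edge, and a dominating set of size
  \<open>\<gamma>(T)\<close> in the subdivision of \<open>uc\<close> would yield a minimum dominating set of \<open>T\<close> that contains \<open>u\<close> or
  dominates \<open>T - uv\<close>. For the second leaf at \<open>v\<close>, take a minimum dominating set with as few private
  neighbours of \<open>v\<close> as possible. Since \<open>v\<close> cannot be exchanged for \<open>u\<close>, it has a private neighbour
  \<open>w \<noteq> u\<close>; by minimality \<open>vw\<close> is a bondage edge as well, so \<open>w\<close> is a leaf too.
\<close>

text \<open>Only arcs leaving \<open>A\<close> are constrained. In a \<open>pair_graph\<close> the
  arcs entering \<open>A\<close> are their reverses, so \<open>e\<close> is then the only edge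
  between \<open>A\<close> and its complement.\<close>

definition edge_cut :: "'a pair_pre_digraph \<Rightarrow> 'a \<times> 'a \<Rightarrow> 'a set \<Rightarrow> bool" where
  "edge_cut G e A \<longleftrightarrow> fst e \<in> A \<and> snd e \<notin> A \<and>
     (\<forall>(x, y) \<in> parcs G. x \<in> A \<longrightarrow> y \<notin> A \<longrightarrow> (x, y) = e)"

text \<open>For \<open>v \<in> D\<close> these are the external private neighbours of
  \<open>v\<close>. For \<open>v \<notin> D\<close> the formula says nothing about adjacency to
  \<open>v\<close>.\<close>

definition private_neighbours :: "'a pair_pre_digraph \<Rightarrow> 'a set \<Rightarrow> 'a \<Rightarrow> 'a set" where
  "private_neighbours G D v = {x \<in> pverts G - D. \<forall>y \<in> D. (y, x) \<in> parcs G \<longleftrightarrow> y = v}"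

definition minimum_dominating_set :: "'a pair_pre_digraph \<Rightarrow> 'a set \<Rightarrow> bool" where
  "minimum_dominating_set G D \<longleftrightarrow> dominating_set G D \<and> card D = domination_number G"

section \<open>Minimum dominating sets\<close>

lemma verts_delete_edge [simp]: "pverts (delete_edge G e) = pverts G"
  by (simp add: delete_edge_def)

lemma arcs_delete_edge [simp]:
  "parcs (delete_edge G (u, v)) = parcs G - {(u, v), (v, u)}"
  by (simp add: delete_edge_def)

lemma dominating_set_if_delete_edge: "dominating_set (delete_edge G (u, v)) D \<Longrightarrow> dominating_set G D"
  unfolding dominating_set_def by auto

lemma domination_number_le:
  assumes "finite (pverts G)" "dominating_set G D"
  shows "domination_number G \<le> card D"
proof -
  have "finite {D. dominating_set G D}"
    by (rule finite_subset[of _ "Pow (pverts G)"]) (use assms in \<open>auto simp: dominating_set_def\<close>)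
  then show ?thesis
    unfolding domination_number_def using assms(2) by (intro Min_le) auto
qed

lemma minimum_dominating_set_exists:
  assumes "finite (pverts G)"
  obtains D where "minimum_dominating_set G D"
proof -
  have "finite {D. dominating_set G D}"
    by (rule finite_subset[of _ "Pow (pverts G)"]) (use assms in \<open>auto simp: dominating_set_def\<close>)
  moreover have "dominating_set G (pverts G)"
    by (simp add: dominating_set_def)
  ultimately have "domination_number G \<in> card ` {D. dominating_set G D}"
    unfolding domination_number_def by (intro Min_in) auto
  then show ?thesis using that by (auto simp: minimum_dominating_set_def)
qed

context pair_graph
begin

lemma arc_swap: "(x, y) \<in> parcs G \<Longrightarrow> (y, x) \<in> parcs G"
  using arcs_symmetric by blast

lemma finite_dominating_set: "dominating_set G D \<Longrightarrow> finite D"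
  unfolding dominating_set_def using pair_finite_verts finite_subset by blast

lemma minimum_dominating_setI:
  "dominating_set G D \<Longrightarrow> card D \<le> domination_number G \<Longrightarrow> minimum_dominating_set G D"
  unfolding minimum_dominating_set_def
  using domination_number_le[OF pair_finite_verts, of D] by simp

lemma leaf_iff:
  assumes "(u, v) \<in> parcs G"
  shows "leaf G u \<longleftrightarrow> (\<forall>c. (u, c) \<in> parcs G \<longrightarrow> c = v)"
proof -
  have "out_arcs (with_proj G) u = Pair u ` {c. (u, c) \<in> parcs G}"
    by auto
  then have "out_degree (with_proj G) u = card {c. (u, c) \<in> parcs G}"
    by (simp add: out_degree_def card_image inj_on_def)
  also have "\<dots> = 1 \<longleftrightarrow> (\<forall>c. (u, c) \<in> parcs G \<longrightarrow> c = v)"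
    using assms by (auto simp: card_1_singleton_iff set_eq_iff)
  finally show ?thesis using assms by (auto simp: leaf_def dest: in_arcsD1)
qed

section \<open>Dominating sets of a subdivided graph\<close>

lemma verts_subdivide_edge:
  "pverts (subdivide_edge G (u, v)) = insert None (Some ` pverts G)"
  by (auto simp: subdivide_edge_def subdivide.simps)

lemma arcs_subdivide_edge:
  "parcs (subdivide_edge G (u, v)) =
     map_prod Some Some ` (parcs G - {(u, v), (v, u)}) \<union>
     {(Some u, None), (None, Some u), (Some v, None), (None, Some v)}"
  by (auto simp: subdivide_edge_def subdivide.simps)

text \<open>The new vertex \<open>None\<close>, added to \<open>S\<close>, dominates both
  \<open>u\<close> and \<open>v\<close>. An old arc into any other vertex survives the
  subdivision.\<close>

lemma domination_number_subdivide_edge_le: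
  assumes "S \<subseteq> pverts G"
    and "\<And>x. x \<in> pverts G - S - {u, v} \<Longrightarrow> \<exists>y \<in> S. (y, x) \<in> parcs G"
  shows "domination_number (subdivide_edge G (u, v)) \<le> Suc (card S)"
proof -
  let ?D = "insert None (Some ` S)"
  have "dominating_set (subdivide_edge G (u, v)) ?D"
    unfolding dominating_set_def
  proof (intro conjI ballI)
    show "?D \<subseteq> pverts (subdivide_edge G (u, v))"
      using assms(1) by (auto simp: verts_subdivide_edge)
  next
    fix z assume "z \<in> pverts (subdivide_edge G (u, v)) - ?D"
    then obtain x where x: "z = Some x" "x \<in> pverts G" "x \<notin> S"
      by (auto simp: verts_subdivide_edge)
    show "\<exists>y \<in> ?D. (y, z) \<in> parcs (subdivide_edge G (u, v))"
    proof (cases "x \<in> {u, v}")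
      case True
      then show ?thesis using x by (auto simp: arcs_subdivide_edge)
    next
      case False
      then obtain y where "y \<in> S" "(y, x) \<in> parcs G" using assms(2) x by blast
      then show ?thesis using False x by (force simp: arcs_subdivide_edge)
    qed
  qed
  moreover have "finite (pverts (subdivide_edge G (u, v)))"
    by (simp add: verts_subdivide_edge)
  moreover have "card ?D = Suc (card S)"
    using finite_subset[OF assms(1)] by (simp add: card_image)
  ultimately show ?thesis using domination_number_le by metis
qed

text \<open>The cases are \<open>None \<notin> D'\<close> and \<open>None \<in> D'\<close>. In the
  first, the old vertices dominate each other without the edge, and one end is present to dominate
  \<open>None\<close>. In the second, \<open>None\<close> takes care of \<open>u\<close> and
  \<open>v\<close>, so its removal leaves exactly the kind of set from which the preceding bound
  starts.\<close>

lemma subdivide_edge_dominating_set_cases: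
  assumes "dominating_set (subdivide_edge G (u, v)) D'"
  obtains (old) D where "dominating_set (delete_edge G (u, v)) D" "card D \<le> card D'" "u \<in> D \<or> v \<in> D"
  | (new) S where "S \<subseteq> pverts G" "Suc (card S) = card D'"
      "\<And>x. x \<in> pverts G - S - {u, v} \<Longrightarrow> \<exists>y \<in> S. (y, x) \<in> parcs G"
proof -
  define S where "S = {x. Some x \<in> D'}"
  have sub: "S \<subseteq> pverts G"
    using assms by (auto simp: S_def dominating_set_def verts_subdivide_edge)
  then have fin: "finite S" using finite_subset[of S] by auto
  have dom: "\<exists>z \<in> D'. (z, Some x) \<in> parcs (subdivide_edge G (u, v))"
    if "x \<in> pverts G" "x \<notin> S" for x
    using assms that by (auto simp: S_def dominating_set_def verts_subdivide_edge)
  show ?thesis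
  proof (cases "None \<in> D'")
    case True
    then have "D' = insert None (Some ` S)"
      unfolding S_def by (auto simp: image_iff) (metis not_None_eq)
    then have "card D' = Suc (card S)" using fin by (simp add: card_image)
    moreover have "\<exists>y \<in> S. (y, x) \<in> parcs G" if "x \<in> pverts G - S - {u, v}" for x
      using dom[of x] that by (auto simp: arcs_subdivide_edge S_def)
    ultimately show ?thesis using new[OF sub] by auto
  next
    case False
    then have D': "D' = Some ` S"
      unfolding S_def by (auto simp: image_iff) (metis not_None_eq)
    then have "card D' = card S" by (simp add: card_image)
    moreover have "dominating_set (delete_edge G (u, v)) S"
      unfolding dominating_set_def using sub dom False
      by (force simp: arcs_subdivide_edge S_def)
    moreover have "\<exists>z \<in> D'. (z, None) \<in> parcs (subdivide_edge G (u, v))"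
      using assms False by (auto simp: dominating_set_def verts_subdivide_edge)
    then have "u \<in> S \<or> v \<in> S"
      by (auto simp: arcs_subdivide_edge S_def)
    ultimately show ?thesis using old by auto
  qed
qed

section \<open>Edge cuts of trees and domination after deleting an edge\<close>

lemma edge_cut_exists:
  assumes "undirected_tree G" "(u, v) \<in> parcs G"
  obtains A where "edge_cut G (u, v) A"
proof -
  let ?H = "delete_edge G (u, v)"
  interpret H: pair_graph ?H by (rule pair_graph_delete_edge) unfold_locales
  \<comment> \<open>The component of \<open>u\<close> after deletion of the edge; it remains to see
    that \<open>v\<close> is not in it.\<close>
  define A where "A = {x. u \<rightarrow>\<^sup>*\<^bsub>with_proj ?H\<^esub> x}"
  have u: "u \<in> pverts G" and uv: "u \<noteq> v"
    using assms(2) no_loops' by (auto dest: in_arcsD1)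
  have "v \<notin> A"
  proof
    assume "v \<in> A"
    then obtain p where "H.apath u p v"
      using H.reachable_apath by (auto simp: A_def)
    then have p: "H.awalk u p v" "distinct (H.awalk_verts u p)"
      by (auto simp: H.apath_def)
    have G_walk: "awalk u p v"
      using p(1) u by (auto simp: awalk_def H.awalk_def cas_with_proj_eq)
    have "p \<noteq> []" using G_walk uv by (auto simp: awalk_Nil_iff)
    \<comment> \<open>A path of one arc would be the deleted edge itself. So \<open>p\<close> has at
      least two arcs, and together with \<open>(v, u)\<close> it closes up to a cycle of length at
      least 3, as \<open>undirected_tree\<close> forbids.\<close>
    moreover have "p \<noteq> [e]" for e
      using p(1) by (cases e) (auto simp: H.awalk_simps)
    ultimately have "length p \<ge> 2"
      by (cases p rule: remdups_adj.cases) auto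
    moreover have "cycle ((v, u) # p)"
      unfolding cycle_def using p(2) G_walk arc_swap[OF assms(2)]
      by (intro exI[of _ v]) (auto simp: awalk_Cons_iff awalk_verts_with_proj_eq)
    ultimately show False
      using assms(1) unfolding undirected_tree_def by fastforce
  qed
  moreover have "u \<in> A" using u by (simp add: A_def)
  moreover have "(x, y) = (u, v)" if "(x, y) \<in> parcs G" "x \<in> A" "y \<notin> A" for x y
  proof (rule ccontr)
    assume "(x, y) \<noteq> (u, v)"
    moreover have "(x, y) \<noteq> (v, u)" using \<open>u \<in> A\<close> that by auto
    ultimately have "(x, y) \<in> parcs ?H" using that by simp
    then have "u \<rightarrow>\<^sup>*\<^bsub>with_proj ?H\<^esub> y"
      using \<open>x \<in> A\<close> by (auto simp: A_def intro: H.reachable_adj_trans)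
    then show False using \<open>y \<notin> A\<close> by (simp add: A_def)
  qed
  ultimately show ?thesis using that[of A] by (auto simp: edge_cut_def)
qed

text \<open>An arc entering \<open>A\<close> is the reverse of one leaving it. Used mostly in
  contraposition: the ends of every other arc are on the same side, so dominating sets can be mixed
  along the cut.\<close>

lemma edge_cut_arc:
  assumes "edge_cut G (u, v) A" "(x, y) \<in> parcs G" "x \<in> A \<longleftrightarrow> y \<notin> A"
  shows "(x, y) = (u, v) \<or> (x, y) = (v, u)"
  using assms arc_swap[OF assms(2)] unfolding edge_cut_def by fastforce

text \<open>Only \<open>u\<close> and \<open>v\<close> can lose a dominator. Each premise saves one
  of them: it lies in \<open>D\<close>, or the other end does not and so never dominated it, or it
  has a further dominator.\<close>

lemma dominating_set_delete_edgeI: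
  assumes "dominating_set G D"
    and "u \<in> D \<or> v \<notin> D \<or> (\<exists>c \<in> D - {v}. (c, u) \<in> parcs G)"
    and "v \<in> D \<or> u \<notin> D \<or> (\<exists>c \<in> D - {u}. (c, v) \<in> parcs G)"
  shows "dominating_set (delete_edge G (u, v)) D"
  unfolding dominating_set_def
proof (intro conjI ballI)
  show "D \<subseteq> pverts (delete_edge G (u, v))" using assms(1) by (simp add: dominating_set_def)
next
  fix x assume x: "x \<in> pverts (delete_edge G (u, v)) - D"
  then obtain y where y: "y \<in> D" "(y, x) \<in> parcs G"
    using assms(1) by (auto simp: dominating_set_def)
  show "\<exists>y \<in> D. (y, x) \<in> parcs (delete_edge G (u, v))"
  proof (cases "(y, x) = (u, v) \<or> (y, x) = (v, u)")
    case True
    then obtain c where "c \<in> D - {y}" "(c, x) \<in> parcs G" using assms(2,3) x y(1) by blast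
    then show ?thesis using True x by auto
  next
    case False
    then show ?thesis using y by auto
  qed
qed

section \<open>Bondage edges and minimum dominating sets\<close>

lemma dominating_set_delete_bondage_edge:
  assumes "bondage_edge G (u, v)" "minimum_dominating_set G D"
  shows "\<not> dominating_set (delete_edge G (u, v)) D"
proof
  assume "dominating_set (delete_edge G (u, v)) D"
  then have "domination_number (delete_edge G (u, v)) \<le> card D"
    by (intro domination_number_le) simp_all
  then show False
    using assms by (auto simp: bondage_edge_def minimum_dominating_set_def)
qed

text \<open>With both ends or neither in \<open>D\<close>, no end relies on the other as a
  dominator, so \<open>D\<close> would survive the deletion.\<close>

lemma bondage_edge_exactly_one:
  assumes "bondage_edge G (u, v)" "minimum_dominating_set G D"
  shows "u \<in> D \<longleftrightarrow> v \<notin> D"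
  using dominating_set_delete_bondage_edge[OF assms] dominating_set_delete_edgeI[of D u v] assms(2)
  by (auto simp: minimum_dominating_set_def)

lemma bondage_edge_only_dominator:
  assumes "bondage_edge G (u, v)" "minimum_dominating_set G D" "v \<in> D" "(c, u) \<in> parcs G" "c \<in> D"
  shows "c = v"
proof (rule ccontr)
  assume "c \<noteq> v"
  have "u \<notin> D" using bondage_edge_exactly_one[OF assms(1,2)] assms(3) by simp
  then have "dominating_set (delete_edge G (u, v)) D"
    using assms(2-) \<open>c \<noteq> v\<close>
    by (intro dominating_set_delete_edgeI) (auto simp: minimum_dominating_set_def)
  then show False using dominating_set_delete_bondage_edge[OF assms(1,2)] by simp
qed

text \<open>Let \<open>w\<close> be a second leaf at \<open>v\<close>. After the deletion
  \<open>u\<close> is isolated and \<open>w\<close> has only the neighbour \<open>v\<close>, so a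
  dominating set contains \<open>u\<close> and one of \<open>v\<close>, \<open>w\<close>. In
  \<open>G\<close> the vertex \<open>v\<close> does the work of all of these, which saves at least
  one vertex.\<close>

lemma bondage_edge_if_leaf_strong_support:
  assumes "(u, v) \<in> parcs G" "leaf G u" "strong_support_vertex G v"
  shows "bondage_edge G (u, v)"
proof -
  let ?H = "delete_edge G (u, v)"
  obtain w where w: "w \<noteq> u" "leaf G w" "(v, w) \<in> parcs G"
  proof -
    let ?L = "{w. leaf G w \<and> (v, w) \<in> parcs G}"
    have "\<not> ?L \<subseteq> {u}"
    proof
      assume "?L \<subseteq> {u}"
      then have "card ?L \<le> card {u}" by (intro card_mono) simp_all
      then show False using assms(3) by (simp add: strong_support_vertex_def)
    qed
    then show ?thesis using that by blast
  qed
  have nbr_u: "c = v" if "(c, u) \<in> parcs G" for c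
    using assms that arc_swap leaf_iff by blast
  have nbr_w: "c = v" if "(c, w) \<in> parcs G" for c
    using w that arc_swap leaf_iff by blast
  have verts: "u \<in> pverts G" "v \<in> pverts G" "w \<in> pverts G" "u \<noteq> v"
    using assms(1) w(3) no_loops' by (auto dest: in_arcsD1 in_arcsD2)
  obtain D where D: "minimum_dominating_set ?H D"
    by (rule minimum_dominating_set_exists[of ?H]) auto
  then have dom: "dominating_set ?H D" and sub: "D \<subseteq> pverts G" and fin: "finite D"
    using finite_dominating_set[OF dominating_set_if_delete_edge]
    by (auto simp: minimum_dominating_set_def dominating_set_def)
  have "u \<in> D"
    using dom verts nbr_u by (auto simp: dominating_set_def)
  have vw: "v \<in> D \<or> w \<in> D"
    using dom verts nbr_w by (fastforce simp: dominating_set_def)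
  let ?D = "insert v (D - {u, w})"
  have "dominating_set G ?D"
    unfolding dominating_set_def
  proof (intro conjI ballI)
    show "?D \<subseteq> pverts G" using sub verts by auto
  next
    fix x assume x: "x \<in> pverts G - ?D"
    show "\<exists>y \<in> ?D. (y, x) \<in> parcs G"
    proof (cases "x \<in> {u, w}")
      case True
      then show ?thesis using arc_swap[OF assms(1)] w by auto
    next
      case False
      then obtain y where "y \<in> D" "(y, x) \<in> parcs G"
        using dom x by (auto simp: dominating_set_def)
      moreover have "y \<noteq> u" "y \<noteq> w"
        using nbr_u nbr_w x arc_swap \<open>(y, x) \<in> parcs G\<close> by blast+
      ultimately show ?thesis by auto
    qed
  qed
  then have "domination_number G \<le> card ?D"
    by (rule domination_number_le[OF pair_finite_verts])
  \<comment> \<open>If \<open>v \<in> D\<close>, then at least \<open>u\<close> is dropped;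
    otherwise both \<open>u\<close> and \<open>w\<close> are traded for \<open>v\<close>.\<close>
  also have "card ?D < card D"
  proof (cases "v \<in> D")
    case True
    then show ?thesis using \<open>u \<in> D\<close> fin verts by (intro psubset_card_mono) auto
  next
    case False
    then have "{u, w} \<subseteq> D" using vw \<open>u \<in> D\<close> by auto
    then have "card (D - {u, w}) = card D - 2" "card D \<ge> 2"
      using w(1) card_mono[OF fin, of "{u, w}"] by (auto simp: card_Diff_subset)
    then show ?thesis using False fin by simp
  qed
  finally show ?thesis
    using D assms(1) by (simp add: bondage_edge_def minimum_dominating_set_def)
qed

end

section \<open>Bondage edges of SR-trees\<close>

locale sr_tree = pair_graph G for G :: "'a pair_pre_digraph" +
  assumes tree: "undirected_tree G" and sr: "sr_graph G"
begin

text \<open>Of the two mixtures of \<open>D\<close> and \<open>D'\<close> along the cut,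
  \<open>?E\<close> contains both ends and \<open>?S\<close> neither. \<open>?E\<close> dominates
  the graph without the edge, so it has more than \<gamma> elements and \<open>?S\<close> has fewer.
  Then \<open>?S\<close> with the new vertex dominates the subdivision with at most \<gamma>
  vertices, against the SR property.\<close>

lemma bondage_edge_same_end:
  assumes bond: "bondage_edge G (u, v)"
    and D: "minimum_dominating_set G D" "v \<in> D"
    and D': "minimum_dominating_set G D'"
  shows "v \<in> D'"
proof (rule ccontr)
  assume "v \<notin> D'"
  then have "u \<in> D'" using bondage_edge_exactly_one[OF bond D'] by simp
  have arc: "(u, v) \<in> parcs G" using bond by (simp add: bondage_edge_def)
  obtain A where A: "edge_cut G (u, v) A" using edge_cut_exists[OF tree arc] .
  then have uv: "u \<in> A" "v \<notin> A" by (auto simp: edge_cut_def)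
  have dom: "dominating_set G D" "dominating_set G D'"
    using D D' by (auto simp: minimum_dominating_set_def)
  have fin: "finite D" "finite D'" using dom finite_dominating_set by auto
  let ?S = "(D \<inter> A) \<union> (D' - A)" and ?E = "(D' \<inter> A) \<union> (D - A)"
  have "dominating_set (delete_edge G (u, v)) ?E"
    unfolding dominating_set_def
  proof (intro conjI ballI)
    show "?E \<subseteq> pverts (delete_edge G (u, v))" using dom by (auto simp: dominating_set_def)
  next
    fix x assume x: "x \<in> pverts (delete_edge G (u, v)) - ?E"
    then have ne: "x \<noteq> u" "x \<noteq> v" using D(2) \<open>u \<in> D'\<close> uv by auto
    have "\<exists>y \<in> (if x \<in> A then D' else D). (y, x) \<in> parcs G"
      using x dom by (auto simp: dominating_set_def)
    then obtain y where y: "y \<in> (if x \<in> A then D' else D)" "(y, x) \<in> parcs G" by blast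
    \<comment> \<open>The edge \<open>uv\<close> alone crosses the cut and \<open>x\<close> is not
      one of its ends, so \<open>x\<close> is dominated from its own side.\<close>
    have "y \<in> A \<longleftrightarrow> x \<in> A" using edge_cut_arc[OF A y(2)] ne by auto
    then show "\<exists>y \<in> ?E. (y, x) \<in> parcs (delete_edge G (u, v))"
      using y ne by (auto split: if_splits)
  qed
  then have "domination_number (delete_edge G (u, v)) \<le> card ?E"
    by (intro domination_number_le) simp_all
  then have less: "domination_number G < card ?E"
    using bond by (simp add: bondage_edge_def)
  have "\<exists>y \<in> ?S. (y, x) \<in> parcs G" if x: "x \<in> pverts G - ?S - {u, v}" for x
  proof -
    have "\<exists>y \<in> (if x \<in> A then D else D'). (y, x) \<in> parcs G"
      using x dom by (auto simp: dominating_set_def)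
    then obtain y where y: "y \<in> (if x \<in> A then D else D')" "(y, x) \<in> parcs G" by blast
    have "y \<in> A \<longleftrightarrow> x \<in> A" using edge_cut_arc[OF A y(2)] x by auto
    then show ?thesis using y by (auto split: if_splits)
  qed
  then have "domination_number (subdivide_edge G (u, v)) \<le> Suc (card ?S)"
    using dom by (intro domination_number_subdivide_edge_le) (auto simp: dominating_set_def)
  moreover have "domination_number (subdivide_edge G (u, v)) > domination_number G"
    using bond sr arc by (simp add: bondage_edge_def sr_graph_def)
  moreover have "card ?S + card ?E = card D + card D'"
  proof -
    have "card ?S = card (D \<inter> A) + card (D' - A)" "card ?E = card (D' \<inter> A) + card (D - A)"
      using fin by (auto intro!: card_Un_disjoint)
    then show ?thesis
      using card_Int_Diff[OF fin(1), of A] card_Int_Diff[OF fin(2), of A] by simp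
  qed
  ultimately show False
    using less D D' by (simp add: minimum_dominating_set_def)
qed

text \<open>Every minimum dominating set contains \<open>v\<close> and avoids \<open>u\<close>. For
  a further neighbour \<open>c\<close> of \<open>u\<close>, both \<open>u\<close> and
  \<open>c\<close> are outside \<open>D\<close>, so \<open>D\<close> does not use \<open>uc\<close>;
  by the SR property \<gamma> vertices suffice for the subdivision of \<open>uc\<close>. Both forms
  of such a dominating set are impossible.\<close>

lemma bondage_edge_leaf:
  assumes bond: "bondage_edge G (u, v)" and D: "minimum_dominating_set G D" "v \<in> D"
  shows "leaf G u"
proof -
  have arc: "(u, v) \<in> parcs G" using bond by (simp add: bondage_edge_def)
  have always: "v \<in> D'" "u \<notin> D'" if "minimum_dominating_set G D'" for D'
    using bondage_edge_same_end[OF bond D that] bondage_edge_exactly_one[OF bond that] by auto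
  have "c = v" if c: "(u, c) \<in> parcs G" for c
  proof (rule ccontr)
    assume "c \<noteq> v"
    have "c \<notin> D"
      using bondage_edge_only_dominator[OF bond D arc_swap[OF c]] \<open>c \<noteq> v\<close> by auto
    moreover have "u \<notin> D" using always D by auto
    ultimately have "dominating_set (delete_edge G (u, c)) D"
      using D by (intro dominating_set_delete_edgeI) (auto simp: minimum_dominating_set_def)
    then have "domination_number (delete_edge G (u, c)) \<le> card D"
      by (intro domination_number_le) simp_all
    then have le: "domination_number (subdivide_edge G (u, c)) \<le> domination_number G"
      using sr c D by (simp add: sr_graph_def minimum_dominating_set_def)
    obtain D' where D': "minimum_dominating_set (subdivide_edge G (u, c)) D'"
      by (rule minimum_dominating_set_exists[of "subdivide_edge G (u, c)"])
        (simp add: verts_subdivide_edge)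
    then have "dominating_set (subdivide_edge G (u, c)) D'"
      by (simp add: minimum_dominating_set_def)
    then show False
    proof (cases rule: subdivide_edge_dominating_set_cases)
      case (old E)
      \<comment> \<open>\<open>E\<close> avoids \<open>u\<close>, so it contains \<open>c\<close>;
        then \<open>u\<close> has the two dominators \<open>v\<close> and \<open>c\<close> in
        \<open>E\<close>.\<close>
      have E: "minimum_dominating_set G E"
        using old le D' dominating_set_if_delete_edge
        by (intro minimum_dominating_setI) (auto simp: minimum_dominating_set_def)
      then have "c \<in> E" using always old by blast
      then show False
        using bondage_edge_only_dominator[OF bond E _ arc_swap[OF c]] always[OF E] \<open>c \<noteq> v\<close> by auto
    next
      case (new S)
      have card_S: "Suc (card S) \<le> domination_number G"
        using new(2) le D' by (simp add: minimum_dominating_set_def)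
      have fin: "finite S" using finite_subset[OF new(1)] by simp
      have verts: "u \<in> pverts G" "c \<in> pverts G" using c by (auto dest: in_arcsD1 in_arcsD2)
      have dom: "dominating_set G (insert u S)" "dominating_set G (insert c S)"
        unfolding dominating_set_def using new(1,3) verts c arc_swap[OF c] by auto
      have "card (insert x S) \<le> domination_number G" for x
        using card_S card_insert_le_m1[of "domination_number G" S x] by simp
      \<comment> \<open>\<open>u\<close> takes the place of the subdivision vertex at the same cost:
        it covers itself and \<open>c\<close>.\<close>
      then have "minimum_dominating_set G (insert u S)"
        using dom by (intro minimum_dominating_setI) auto
      then show False using always by blast
    qed
  qed
  then show ?thesis using leaf_iff[OF arc] by blast
qed

text \<open>The witness replaces \<open>D\<close> by \<open>D'\<close> on the side of \<open>w\<close> in the tree cut at \<open>vw\<close>.\<close>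

lemma exchange_private_neighbour:
  assumes D: "minimum_dominating_set G D" "v \<in> D"
    and w: "w \<in> private_neighbours G D v"
    and D': "minimum_dominating_set G D'" "v \<in> D'" "w \<notin> private_neighbours G D' v"
  obtains E where "minimum_dominating_set G E" "v \<in> E"
    "private_neighbours G E v \<subset> private_neighbours G D v"
proof -
  have dom: "dominating_set G D" "dominating_set G D'"
    using D D' by (auto simp: minimum_dominating_set_def)
  have fin: "finite D" "finite D'" using dom finite_dominating_set by auto
  have arc: "(w, v) \<in> parcs G"
    using w D(2) arc_swap by (auto simp: private_neighbours_def)
  obtain A where A: "edge_cut G (w, v) A" using edge_cut_exists[OF tree arc] .
  then have wv: "w \<in> A" "v \<notin> A" by (auto simp: edge_cut_def)
  have w_D: "w \<in> pverts G" "w \<notin> D" using w by (auto simp: private_neighbours_def)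
  let ?S = "(D \<inter> A) \<union> (D' - A)" and ?E = "(D' \<inter> A) \<union> (D - A)"
  \<comment> \<open>Otherwise \<open>w\<close> is dominated in \<open>D'\<close> only across the
    cut, hence only by \<open>v\<close>, and would be private.\<close>
  have w_E: "w \<in> D' \<or> (\<exists>y \<in> D' \<inter> A. (y, w) \<in> parcs G)"
  proof (rule ccontr)
    assume none: "\<not> ?thesis"
    have "y = v" if "y \<in> D'" "(y, w) \<in> parcs G" for y
    proof -
      have "y \<notin> A" using that none by blast
      then show ?thesis using edge_cut_arc[OF A that(2)] wv by blast
    qed
    then have "w \<in> private_neighbours G D' v"
      using none w_D arc_swap[OF arc] unfolding private_neighbours_def by blast
    then show False using D'(3) by simp
  qed
  \<comment> \<open>\<open>?S\<close> serves the count: it has at least \<gamma> elements, so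
    \<open>?E\<close> has at most \<gamma>. Its vertices in \<open>A\<close> dominate as in
    \<open>D\<close>, except that \<open>w\<close> is dominated by
    \<open>v \<in> D'\<close>.\<close>
  have "dominating_set G ?S"
    unfolding dominating_set_def
  proof (intro conjI ballI)
    show "?S \<subseteq> pverts G" using dom by (auto simp: dominating_set_def)
  next
    fix x assume x: "x \<in> pverts G - ?S"
    have "\<exists>y \<in> (if x \<in> A then D else D'). (y, x) \<in> parcs G"
      using x dom by (auto simp: dominating_set_def)
    then obtain y where y: "y \<in> (if x \<in> A then D else D')" "(y, x) \<in> parcs G" by blast
    show "\<exists>y \<in> ?S. (y, x) \<in> parcs G"
    proof (cases "x = w")
      case True
      then show ?thesis using D'(2) wv arc_swap[OF arc] by auto
    next
      case False
      then have "y \<in> A \<longleftrightarrow> x \<in> A" using edge_cut_arc[OF A y(2)] x D'(2) wv by auto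
      then show ?thesis using y by (auto split: if_splits)
    qed
  qed
  then have S: "domination_number G \<le> card ?S"
    by (rule domination_number_le[OF pair_finite_verts])
  have "dominating_set G ?E"
    unfolding dominating_set_def
  proof (intro conjI ballI)
    show "?E \<subseteq> pverts G" using dom by (auto simp: dominating_set_def)
  next
    fix x assume x: "x \<in> pverts G - ?E"
    have "\<exists>y \<in> (if x \<in> A then D' else D). (y, x) \<in> parcs G"
      using x dom by (auto simp: dominating_set_def)
    then obtain y where y: "y \<in> (if x \<in> A then D' else D)" "(y, x) \<in> parcs G" by blast
    show "\<exists>y \<in> ?E. (y, x) \<in> parcs G"
    proof (cases "x = w")
      case True
      then show ?thesis using w_E x wv by auto
    next
      case False
      then have "y \<in> A \<longleftrightarrow> x \<in> A" using edge_cut_arc[OF A y(2)] x D(2) wv by auto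
      then show ?thesis using y by (auto split: if_splits)
    qed
  qed
  moreover have "card ?S + card ?E = card D + card D'"
  proof -
    have "card ?S = card (D \<inter> A) + card (D' - A)" "card ?E = card (D' \<inter> A) + card (D - A)"
      using fin by (auto intro!: card_Un_disjoint)
    then show ?thesis
      using card_Int_Diff[OF fin(1), of A] card_Int_Diff[OF fin(2), of A] by simp
  qed
  ultimately have "minimum_dominating_set G ?E"
    using S D D' by (intro minimum_dominating_setI) (auto simp: minimum_dominating_set_def)
  moreover have v_E: "v \<in> ?E" using D(2) wv by simp
  \<comment> \<open>By \<open>w_E\<close>, \<open>w\<close> is no longer private. Every other
    neighbour of \<open>v\<close> lies outside \<open>A\<close>, where \<open>?E\<close> and
    \<open>D\<close> agree; a dominator of it in \<open>D\<close> from within \<open>A\<close> could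
    only be \<open>w\<close>, which is not in \<open>D\<close>.\<close>
  moreover have "private_neighbours G ?E v \<subseteq> private_neighbours G D v"
  proof
    fix x assume x: "x \<in> private_neighbours G ?E v"
    then have vx: "(v, x) \<in> parcs G" "x \<in> pverts G" "x \<notin> ?E"
      using v_E by (auto simp: private_neighbours_def)
    have "x \<noteq> w"
      using x w_E wv by (auto simp: private_neighbours_def)
    then have "x \<notin> A" using edge_cut_arc[OF A vx(1)] wv by auto
    have "y = v" if "y \<in> D" "(y, x) \<in> parcs G" for y
    proof -
      have "y \<notin> A" using edge_cut_arc[OF A that(2)] \<open>x \<notin> A\<close> that w_D(2) wv by auto
      then show ?thesis using x that by (auto simp: private_neighbours_def)
    qed
    moreover have "x \<in> pverts G - D" using vx \<open>x \<notin> A\<close> by blast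
    ultimately show "x \<in> private_neighbours G D v"
      using vx(1) unfolding private_neighbours_def by blast
  qed
  moreover have "w \<notin> private_neighbours G ?E v"
    using w_E wv by (auto simp: private_neighbours_def)
  ultimately show ?thesis using that w by blast
qed

lemma bondage_edge_strong_support:
  assumes bond: "bondage_edge G (u, v)" and D0: "minimum_dominating_set G D\<^sub>0" "v \<in> D\<^sub>0"
  shows "strong_support_vertex G v"
proof -
  have arc: "(u, v) \<in> parcs G" using bond by (simp add: bondage_edge_def)
  have always: "v \<in> D'" "u \<notin> D'" if "minimum_dominating_set G D'" for D'
    using bondage_edge_same_end[OF bond D0 that] bondage_edge_exactly_one[OF bond that] by auto
  obtain D where D: "minimum_dominating_set G D"
    and least: "\<And>D'. minimum_dominating_set G D' \<Longrightarrow>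
      card (private_neighbours G D v) \<le> card (private_neighbours G D' v)"
    using ex_has_least_nat[of "minimum_dominating_set G", OF D0(1),
        of "\<lambda>D. card (private_neighbours G D v)"] by blast
  note vD = always[OF D]
  have dom: "dominating_set G D" and fin: "finite D"
    using D finite_dominating_set by (auto simp: minimum_dominating_set_def)
  let ?D' = "insert u (D - {v})"
  \<comment> \<open>\<open>?D'\<close> is as large as \<open>D\<close> but contains
    \<open>u\<close>. The vertex \<open>w\<close> that it misses is not \<open>v\<close>, which
    \<open>u\<close> dominates; so \<open>w\<close> lies outside \<open>D\<close> and only
    \<open>v\<close> dominates it there.\<close>
  have "\<not> dominating_set G ?D'"
  proof
    assume "dominating_set G ?D'"
    moreover have "card ?D' = card D"
      using vD fin card_Suc_Diff1[OF fin vD(1)] by simp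
    ultimately have "minimum_dominating_set G ?D'"
      using D by (simp add: minimum_dominating_set_def)
    then show False using always by blast
  qed
  moreover have "?D' \<subseteq> pverts G"
    using dom arc by (auto simp: dominating_set_def dest: in_arcsD1)
  ultimately obtain w where w: "w \<in> pverts G" "w \<notin> ?D'" "\<And>y. y \<in> ?D' \<Longrightarrow> (y, w) \<notin> parcs G"
    by (auto simp: dominating_set_def)
  have "w \<noteq> v" using w(3)[of u] arc by auto
  then have "w \<in> pverts G - D" using w(1,2) by blast
  then obtain y where "y \<in> D" "(y, w) \<in> parcs G"
    using dom unfolding dominating_set_def by blast
  then have vw: "(v, w) \<in> parcs G" using w(3)[of y] by auto
  then have priv: "w \<in> private_neighbours G D v"
    using w \<open>w \<noteq> v\<close> by (auto simp: private_neighbours_def)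
  \<comment> \<open>Otherwise a minimum dominating set of the graph without \<open>vw\<close> is
    also minimum in \<open>G\<close>, and \<open>w\<close> is not private to \<open>v\<close> in it.
    The exchange then contradicts the choice of \<open>D\<close>.\<close>
  have "bondage_edge G (w, v)"
  proof (rule ccontr)
    assume not_bond: "\<not> bondage_edge G (w, v)"
    obtain D' where D': "minimum_dominating_set (delete_edge G (w, v)) D'"
      by (rule minimum_dominating_set_exists[of "delete_edge G (w, v)"]) auto
    then have dom': "dominating_set (delete_edge G (w, v)) D'"
      by (simp add: minimum_dominating_set_def)
    have min': "minimum_dominating_set G D'"
      using not_bond arc_swap[OF vw] D' dominating_set_if_delete_edge[OF dom']
      by (intro minimum_dominating_setI) (auto simp: bondage_edge_def minimum_dominating_set_def)
    have "w \<notin> private_neighbours G D' v"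
    proof
      assume w': "w \<in> private_neighbours G D' v"
      then have "w \<in> pverts (delete_edge G (w, v)) - D'"
        by (simp add: private_neighbours_def)
      then obtain y where y: "y \<in> D'" "(y, w) \<in> parcs (delete_edge G (w, v))"
        using dom' unfolding dominating_set_def by blast
      then have "y = v" using w' unfolding private_neighbours_def by simp
      then show False using y(2) by simp
    qed
    then obtain E where "minimum_dominating_set G E"
      "private_neighbours G E v \<subset> private_neighbours G D v"
      by (rule exchange_private_neighbour[OF D vD(1) priv min' always(1)[OF min']])
    moreover have "finite (private_neighbours G D v)"
      by (simp add: private_neighbours_def)
    ultimately show False
      using least[of E] psubset_card_mono[of "private_neighbours G D v"] by (meson leD)
  qed
  then have "leaf G w" using bondage_edge_leaf[OF _ D vD(1)] by blast
  moreover have "leaf G u" using bondage_edge_leaf[OF bond D vD(1)] .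
  ultimately have "{u, w} \<subseteq> {w. leaf G w \<and> (v, w) \<in> parcs G}"
    using vw arc_swap[OF arc] by auto
  moreover have "finite {w. leaf G w \<and> (v, w) \<in> parcs G}"
    by (rule finite_subset[of _ "pverts G"]) (auto simp: leaf_def)
  ultimately have "card {u, w} \<le> card {w. leaf G w \<and> (v, w) \<in> parcs G}"
    by (intro card_mono)
  then show ?thesis
    using w(2) vw by (auto simp: strong_support_vertex_def dest: in_arcsD1)
qed

end

theorem theorem9:
  fixes T :: "'a pair_pre_digraph" and u v :: 'a
  assumes "undirected_tree T"
    and "sr_graph T"
    and "(u, v) \<in> parcs T"
  shows "bondage_edge T (u, v) \<longleftrightarrow>
    (leaf T u \<and> strong_support_vertex T v) \<or> (leaf T v \<and> strong_support_vertex T u)"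
proof -
  interpret pair_graph T using assms(1) by (simp add: undirected_tree_def)
  interpret sr_tree T using assms by unfold_locales
  have swap: "bondage_edge T (u, v) \<longleftrightarrow> bondage_edge T (v, u)"
    using assms(3) arc_swap by (auto simp: bondage_edge_def delete_edge_swap)
  show ?thesis
  proof
    assume bond: "bondage_edge T (u, v)"
    obtain D where D: "minimum_dominating_set T D"
      by (rule minimum_dominating_set_exists[of T]) auto
    \<comment> \<open>The lemmas expect the end in \<open>D\<close> as the second component, so
      \<open>u \<in> D\<close> uses them for \<open>(v, u)\<close>.\<close>
    consider "v \<in> D" | "u \<in> D" using bondage_edge_exactly_one[OF bond D] by blast
    then show "(leaf T u \<and> strong_support_vertex T v) \<or> (leaf T v \<and> strong_support_vertex T u)"
      using bondage_edge_leaf[OF _ D] bondage_edge_strong_support[OF _ D] bond swap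
      by metis
  next
    assume "(leaf T u \<and> strong_support_vertex T v) \<or> (leaf T v \<and> strong_support_vertex T u)"
    then show "bondage_edge T (u, v)"
      using bondage_edge_if_leaf_strong_support assms(3) arc_swap swap by blast
  qed
qed

end
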